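(* Let $(X,d)$ be a nonempty complete metric space and let $T:X\to X$ be variable-factor logically contractive with factors $(\lambda_k)_{k\ge1}\subset(0,1]$ and events $n_1<n_2<\cdots$. Put $\Lambda_k:=\prod_{i=1}^k\lambda_i$, assume that $\Lambda_k<1$ for some $k$, let $k_\ast:=\min\{k\ge 1:\Lambda_k<1\}$, and let $z$ be the unique fixed point of $T^{n_{k_\ast}}$ (which is also a fixed point of $T$). Then: 1. For all $x\in X$ and $k\ge 1$, $d(T^{n_k}x,z)\le\Lambda_k\,d(x,z)$. 2. If $\Lambda_k\to 0$ (equivalently $\prod_{k=1}^\infty\lambda_k=0$, or equivalently $\sum_{k=1}^\infty -\ln\lambda_k=\infty$), then $T^nx\to z$ as $n\to\infty$ for every $x\in X$. 3. If $\sup_k(n_{k+1}-n_k)\le M<\infty$, then for all $x\in X$ and all integers $n\ge n_1$, $$d(T^nx,z)\;\le\;\Lambda_{\,1+\left\lfloor\frac{n-n_1}{M}\right\rfloor}\,d(x,z).$$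
   Context: For a self-map $T$ of a metric space $(X,d)$ and a positive integer $n$, $T^n$ denotes the $n$-fold composition (so $T^1=T$). $T$ is nonexpansive if $d(Tx,Ty)\le d(x,y)$ for all $x,y\in X$. $\lfloor t\rfloor$ is the greatest integer $\le t$. Definition: a nonexpansive map $T:X\to X$ is variable-factor logically contractive (VLC), with events $(n_k)$ and factors $(\lambda_k)$, if there exist a strictly increasing sequence of positive integers $n_1<n_2<\cdots$ and factors $\lambda_k\in(0,1]$ such that for all $k\ge 1$ and all $x,y\in X$, $$d(T^{n_k}x,T^{n_k}y)\le\Big(\prod_{i=1}^k\lambda_i\Big)d(x,y).$$ When $\Lambda_k=\prod_{i=1}^k\lambda_i<1$ for some $k$, the map $T^{n_{k_\ast}}$ is a Banach contraction of the complete space $X$, so it has a unique fixed point $z$, and $Tz=z$. *)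

theory Defs
  imports "HOL-Analysis.Analysis"
begin

definition nonexpansive_map :: "'a set \<Rightarrow> ('a \<Rightarrow> 'a \<Rightarrow> real) \<Rightarrow> ('a \<Rightarrow> 'a) \<Rightarrow> bool"
  where "nonexpansive_map X d T \<longleftrightarrow>
    T \<in> X \<rightarrow> X \<and> (\<forall>x\<in>X. \<forall>y\<in>X. d (T x) (T y) \<le> d x y)"

(* Events n and factors lam are indexed from 1; their values at 0 are irrelevant. *)

definition cum_factor :: "(nat \<Rightarrow> real) \<Rightarrow> nat \<Rightarrow> real"
  where "cum_factor lam k = (\<Prod>i=1..k. lam i)"

definition vlc_with ::
    "'a set \<Rightarrow> ('a \<Rightarrow> 'a \<Rightarrow> real) \<Rightarrow> ('a \<Rightarrow> 'a) \<Rightarrow> (nat \<Rightarrow> nat) \<Rightarrow> (nat \<Rightarrow> real) \<Rightarrow> bool"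
  where "vlc_with X d T n lam \<longleftrightarrow>
    nonexpansive_map X d T \<and>
    (\<forall>k\<ge>1. 0 < n k) \<and> strict_mono_on {1..} n \<and>
    (\<forall>k\<ge>1. 0 < lam k \<and> lam k \<le> 1) \<and>
    (\<forall>k\<ge>1. \<forall>x\<in>X. \<forall>y\<in>X.
       d ((T ^^ n k) x) ((T ^^ n k) y) \<le> cum_factor lam k * d x y)"

definition first_contraction :: "(nat \<Rightarrow> real) \<Rightarrow> nat"
  where "first_contraction lam = (LEAST k. 1 \<le> k \<and> cum_factor lam k < 1)"

end

theory Submission
  imports Defs
begin

text \<open>
  The proof rests on one monotonicity. If \<open>z\<close> is a fixed point of \<open>T\<close>, then nonexpansiveness makes
  \<open>m \<mapsto> d (T\<^sup>m x) z\<close> nonincreasing, so an estimate at an event \<open>n k\<close> persists at every later time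
  (\<open>funpow_dist_fixpoint_le\<close>). The event inequality with \<open>y = z\<close> is such an estimate, with factor
  \<open>cum_factor lam k\<close>. If these factors tend to \<open>0\<close>, letting \<open>k\<close> grow yields convergence of the orbit; choosing for a given time
  \<open>m\<close> an event that has certainly occurred by then yields the rate: if consecutive events are at most \<open>M\<close>
  apart, event number \<open>1 + \<lfloor>(m - n 1) / M\<rfloor>\<close> has occurred by time \<open>m\<close>.

  The fixed point itself comes from the Banach theorem applied to the iterate at the first event
  with cumulative factor below one. Since \<open>T\<close> commutes with its own iterates, \<open>T\<close> maps a fixed
  point of that iterate to another one, and uniqueness makes it a fixed point of \<open>T\<close>.

  The equivalent forms of \<open>\<Lambda>\<^sub>k \<longlonglongrightarrow> 0\<close> hold because the products decrease and stay positive, hence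
  converge, and because \<open>-ln\<close> turns the products into the partial sums of the series and carries
  the limit \<open>0\<close> to \<open>\<infinity>\<close>.
\<close>

section \<open>Cumulative products of factors in the unit interval\<close>

lemma cum_factor_Suc: "cum_factor lam (Suc k) = cum_factor lam k * lam (Suc k)"
  by (simp add: cum_factor_def)

lemma cum_factor_pos:
  assumes "\<forall>k\<ge>1. 0 < lam k"
  shows "0 < cum_factor lam k"
  unfolding cum_factor_def using assms by (intro prod_pos) auto

lemma decseq_cum_factor:
  assumes "\<forall>k\<ge>1. 0 < lam k \<and> lam k \<le> 1"
  shows "decseq (cum_factor lam)"
proof (rule decseq_SucI)
  fix k
  have "0 < cum_factor lam k"
    using assms by (intro cum_factor_pos) auto
  then show "cum_factor lam (Suc k) \<le> cum_factor lam k"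
    using assms by (simp add: cum_factor_Suc mult_left_le)
qed

text \<open>The value of \<open>lim\<close> carries information only for a convergent sequence; here convergence is
  guaranteed by monotonicity.\<close>

lemma cum_factor_tendsto_0_iff_lim:
  assumes lam: "\<forall>k\<ge>1. 0 < lam k \<and> lam k \<le> 1"
  shows "cum_factor lam \<longlonglongrightarrow> 0 \<longleftrightarrow> lim (\<lambda>K. \<Prod>k=1..K. lam k) = 0"
proof -
  have "\<forall>k. 0 \<le> cum_factor lam k"
    using lam by (auto intro!: less_imp_le cum_factor_pos)
  then have "convergent (cum_factor lam)"
    using decseq_convergent[OF decseq_cum_factor[OF lam]] by (metis convergentI)
  then have "cum_factor lam \<longlonglongrightarrow> lim (cum_factor lam)"
    by (simp add: convergent_LIMSEQ_iff)
  moreover have "(\<lambda>K. \<Prod>k=1..K. lam k) = cum_factor lam"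
    by (simp add: cum_factor_def fun_eq_iff)
  ultimately show ?thesis
    by (metis limI)
qed

lemma sum_neg_ln_eq_neg_ln_cum_factor:
  assumes "\<forall>k\<ge>1. 0 < lam k"
  shows "(\<Sum>k<K. - ln (lam (Suc k))) = - ln (cum_factor lam K)"
proof (induction K)
  case 0
  show ?case by (simp add: cum_factor_def)
next
  case (Suc K)
  have "0 < lam (Suc K)"
    using assms by simp
  then have "ln (cum_factor lam (Suc K)) = ln (cum_factor lam K) + ln (lam (Suc K))"
    using cum_factor_pos[OF assms, of K] by (simp add: cum_factor_Suc ln_mult)
  then show ?case
    using Suc.IH by simp
qed

text \<open>The logarithmic series has nonnegative terms, so its partial sums converge in the extended
  reals in any case, and its sum is \<open>\<infinity>\<close> exactly when these partial sums, which are \<open>-ln\<close> of the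
  products, tend to infinity.\<close>

lemma cum_factor_tendsto_0_iff_suminf_ln:
  assumes lam: "\<forall>k\<ge>1. 0 < lam k \<and> lam k \<le> 1"
  shows "cum_factor lam \<longlonglongrightarrow> 0 \<longleftrightarrow> (\<Sum>k. ereal (- ln (lam (Suc k)))) = \<infinity>"
proof -
  have pos: "0 < cum_factor lam k" for k
    using lam by (intro cum_factor_pos) auto
  define S where "S = (\<Sum>k. ereal (- ln (lam (Suc k))))"
  have "0 \<le> ereal (- ln (lam (Suc k)))" for k
    using lam by simp
  then have "(\<lambda>K. \<Sum>k<K. ereal (- ln (lam (Suc k)))) \<longlonglongrightarrow> S"
    unfolding S_def by (intro summable_LIMSEQ summable_ereal_pos)
  then have S: "(\<lambda>K. ereal (- ln (cum_factor lam K))) \<longlonglongrightarrow> S"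
    using lam by (simp add: sum_neg_ln_eq_neg_ln_cum_factor)
  have "S = \<infinity> \<longleftrightarrow> (\<lambda>K. ereal (- ln (cum_factor lam K))) \<longlonglongrightarrow> \<infinity>"
    using S LIMSEQ_unique by blast
  also have "\<dots> \<longleftrightarrow> filterlim (\<lambda>K. ln (cum_factor lam K)) at_bot sequentially"
    unfolding tendsto_PInfty_eq_at_top filterlim_uminus_at_top by simp
  also have "\<dots> \<longleftrightarrow> cum_factor lam \<longlonglongrightarrow> 0"
  proof
    assume "filterlim (\<lambda>K. ln (cum_factor lam K)) at_bot sequentially"
    then have "(\<lambda>K. exp (ln (cum_factor lam K))) \<longlonglongrightarrow> 0"
      by (rule filterlim_compose[OF exp_at_bot])
    then show "cum_factor lam \<longlonglongrightarrow> 0"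
      using pos by simp
  next
    assume "cum_factor lam \<longlonglongrightarrow> 0"
    then have "filterlim (cum_factor lam) (at_right 0) sequentially"
      using pos by (simp add: filterlim_at less_imp_neq[THEN not_sym])
    then show "filterlim (\<lambda>K. ln (cum_factor lam K)) at_bot sequentially"
      by (rule filterlim_compose[OF ln_at_0])
  qed
  finally show ?thesis
    by (simp add: S_def)
qed

section \<open>Orbits of nonexpansive maps\<close>

lemma funpow_mem:
  assumes "T \<in> X \<rightarrow> X" "x \<in> X"
  shows "(T ^^ m) x \<in> X"
  using assms by (induction m) auto

lemma funpow_fixpoint:
  assumes "T z = z"
  shows "(T ^^ m) z = z"
  using assms by (induction m) auto

text \<open>Distances to a fixed point never increase along an orbit; this turns estimates at isolated
  times into estimates at all later times.\<close>

lemma funpow_dist_fixpoint_le: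
  assumes T: "nonexpansive_map X d T" and "T z = z" "x \<in> X" "z \<in> X" "k \<le> m"
  shows "d ((T ^^ m) x) z \<le> d ((T ^^ k) x) z"
  using \<open>k \<le> m\<close>
proof (induction m rule: dec_induct)
  case base
  show ?case by simp
next
  case (step m)
  have "(T ^^ m) x \<in> X"
    using T \<open>x \<in> X\<close> by (intro funpow_mem) (auto simp: nonexpansive_map_def)
  then have "d (T ((T ^^ m) x)) (T z) \<le> d ((T ^^ m) x) z"
    using T \<open>z \<in> X\<close> by (simp add: nonexpansive_map_def)
  then show ?case
    using step.IH \<open>T z = z\<close> by simp
qed

text \<open>Commutation of \<open>T\<close> with \<open>T ^^ N\<close> makes \<open>T z\<close> a fixed point of \<open>T ^^ N\<close> whenever \<open>z\<close> is one;
  uniqueness in the Banach theorem then forces \<open>T z = z\<close>.\<close>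

lemma (in Metric_space) contractive_iterate_fixpoint:
  assumes "mcomplete" "M \<noteq> {}" and T: "T \<in> M \<rightarrow> M" and "c < 1"
    and con: "\<And>x y. x \<in> M \<Longrightarrow> y \<in> M \<Longrightarrow> d ((T ^^ N) x) ((T ^^ N) y) \<le> c * d x y"
  shows "\<exists>!z. z \<in> M \<and> (T ^^ N) z = z"
    and "z \<in> M \<Longrightarrow> (T ^^ N) z = z \<Longrightarrow> T z = z"
proof -
  have self: "T ^^ N \<in> M \<rightarrow> M"
    using T by (auto intro: funpow_mem)
  have uniq: "u = v" if "u \<in> M" "v \<in> M" "(T ^^ N) u = u" "(T ^^ N) v = v" for u v
    using contraction_imp_unique_fixpoint[of "T ^^ N" u v c] that self \<open>c < 1\<close> con by blast
  obtain w where "w \<in> M" "(T ^^ N) w = w"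
    using Banach_fixedpoint_thm[OF \<open>mcomplete\<close> \<open>M \<noteq> {}\<close> self \<open>c < 1\<close> con] by blast
  then show "\<exists>!z. z \<in> M \<and> (T ^^ N) z = z"
    using uniq by blast
  show "T z = z" if "z \<in> M" "(T ^^ N) z = z"
  proof (rule uniq)
    show "T z \<in> M" using T that by auto
    show "(T ^^ N) (T z) = T z" using that by (simp flip: funpow_swap1)
  qed (use that in auto)
qed

section \<open>Variable-factor logical contractions\<close>

lemma vlc_dist_fixpoint_le:
  assumes vlc: "vlc_with X d T n lam" and "T z = z" "x \<in> X" "z \<in> X" "1 \<le> k" "n k \<le> m"
  shows "d ((T ^^ m) x) z \<le> cum_factor lam k * d x z"
proof -
  have "(T ^^ n k) z = z"
    using \<open>T z = z\<close> by (rule funpow_fixpoint)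
  have "d ((T ^^ m) x) z \<le> d ((T ^^ n k) x) z"
    using assms by (intro funpow_dist_fixpoint_le) (auto simp: vlc_with_def)
  also have "\<dots> = d ((T ^^ n k) x) ((T ^^ n k) z)"
    by (simp add: \<open>(T ^^ n k) z = z\<close>)
  also have "\<dots> \<le> cum_factor lam k * d x z"
    using vlc \<open>x \<in> X\<close> \<open>z \<in> X\<close> \<open>1 \<le> k\<close> by (simp add: vlc_with_def)
  finally show ?thesis .
qed

text \<open>At time \<open>m\<close> every event \<open>k\<close> with \<open>n k \<le> m\<close> may be used, so one event with
  \<open>cum_factor lam k * d x z\<close> below the tolerance controls the whole tail of the orbit.\<close>

lemma (in Metric_space) vlc_orbit_tendsto:
  assumes vlc: "vlc_with M d T n lam" and "T z = z" "x \<in> M" "z \<in> M"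
    and lim0: "cum_factor lam \<longlonglongrightarrow> 0"
  shows "limitin mtopology (\<lambda>m. (T ^^ m) x) z sequentially"
proof -
  have T: "T \<in> M \<rightarrow> M"
    using vlc by (simp add: vlc_with_def nonexpansive_map_def)
  have "\<exists>N. \<forall>m\<ge>N. (T ^^ m) x \<in> M \<and> d ((T ^^ m) x) z < \<epsilon>" if "0 < \<epsilon>" for \<epsilon>
  proof -
    have "(\<lambda>k. cum_factor lam k * d x z) \<longlonglongrightarrow> 0"
      using tendsto_mult_left_zero[OF lim0] .
    then have "\<forall>\<^sub>F k in sequentially. cum_factor lam k * d x z < \<epsilon> \<and> 1 \<le> k"
      using that by (intro eventually_conj order_tendstoD eventually_ge_at_top)
    then obtain k where k: "cum_factor lam k * d x z < \<epsilon>" "1 \<le> k"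
      using eventually_happens[of _ sequentially] by auto
    have "d ((T ^^ m) x) z < \<epsilon>" if "n k \<le> m" for m
      using vlc_dist_fixpoint_le[OF vlc \<open>T z = z\<close> \<open>x \<in> M\<close> \<open>z \<in> M\<close> \<open>1 \<le> k\<close> that] k(1) by simp
    then show ?thesis
      using funpow_mem[OF T \<open>x \<in> M\<close>] by blast
  qed
  then show ?thesis
    using \<open>z \<in> M\<close> by (auto simp: limit_metric_sequentially)
qed

lemma event_le_of_bounded_gaps:
  fixes n :: "nat \<Rightarrow> nat" and B :: real
  assumes "\<And>k. 1 \<le> k \<Longrightarrow> real (n (Suc k)) - real (n k) \<le> B"
  shows "real (n (1 + j)) \<le> real (n 1) + real j * B"
proof (induction j)
  case 0
  show ?case by simp
next
  case (Suc j)
  then show ?case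
    using assms[of "1 + j"] by (simp add: algebra_simps)
qed

text \<open>The index in the rate is the largest one that the gap bound alone guarantees to have occurred
  by time \<open>m\<close>. Dividing by \<open>B\<close> makes sense because strictly increasing events force \<open>B > 0\<close>.\<close>

lemma vlc_rate_of_bounded_gaps:
  fixes B :: real
  assumes vlc: "vlc_with X d T n lam" and "T z = z" "x \<in> X" "z \<in> X" "n 1 \<le> m"
    and gap: "\<And>k. 1 \<le> k \<Longrightarrow> real (n (Suc k)) - real (n k) \<le> B"
  shows "d ((T ^^ m) x) z \<le> cum_factor lam (1 + nat \<lfloor>(real m - real (n 1)) / B\<rfloor>) * d x z"
proof (rule vlc_dist_fixpoint_le[OF vlc \<open>T z = z\<close> \<open>x \<in> X\<close> \<open>z \<in> X\<close>])
  define j where "j = nat \<lfloor>(real m - real (n 1)) / B\<rfloor>"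
  have "strict_mono_on {1..} n"
    using vlc by (simp add: vlc_with_def)
  then have "n 1 < n (Suc 1)"
    by (rule strict_mono_onD) auto
  then have "0 < B"
    using gap[of 1] by simp
  then have "real j \<le> (real m - real (n 1)) / B"
    using \<open>n 1 \<le> m\<close> by (simp add: j_def)
  then have "real j * B \<le> real m - real (n 1)"
    using \<open>0 < B\<close> by (simp add: pos_le_divide_eq)
  then have "real (n (1 + j)) \<le> real m"
    using event_le_of_bounded_gaps[of n B j, OF gap] by linarith
  then show "n (1 + nat \<lfloor>(real m - real (n 1)) / B\<rfloor>) \<le> m"
    by (simp add: j_def)
qed simp

theorem theorem4p2:
  fixes X :: "'a set" and d :: "'a \<Rightarrow> 'a \<Rightarrow> real" and T :: "'a \<Rightarrow> 'a"
    and n :: "nat \<Rightarrow> nat" and lam :: "nat \<Rightarrow> real"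
  assumes "Metric_space X d" and "Metric_space.mcomplete X d" and "X \<noteq> {}"
    and "vlc_with X d T n lam"
    and "\<exists>k\<ge>1. cum_factor lam k < 1"
  shows "(\<exists>!z. z \<in> X \<and> (T ^^ n (first_contraction lam)) z = z) \<and>
    (cum_factor lam \<longlonglongrightarrow> 0 \<longleftrightarrow> lim (\<lambda>K. \<Prod>k=1..K. lam k) = 0) \<and>
    (cum_factor lam \<longlonglongrightarrow> 0 \<longleftrightarrow> (\<Sum>k. ereal (- ln (lam (Suc k)))) = \<infinity>) \<and>
    (\<forall>z\<in>X. (T ^^ n (first_contraction lam)) z = z \<longrightarrow>
      T z = z \<and>
      (\<forall>x\<in>X. \<forall>k\<ge>1. d ((T ^^ n k) x) z \<le> cum_factor lam k * d x z) \<and>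
      (cum_factor lam \<longlonglongrightarrow> 0 \<longrightarrow>
        (\<forall>x\<in>X. limitin (Metric_space.mtopology X d) (\<lambda>m. (T ^^ m) x) z sequentially)) \<and>
      (\<forall>M::real. (SUP k\<in>{1..}. ereal (real (n (Suc k)) - real (n k))) \<le> ereal M \<longrightarrow>
        (\<forall>x\<in>X. \<forall>m\<ge>n 1.
          d ((T ^^ m) x) z \<le>
            cum_factor lam (1 + nat \<lfloor>(real m - real (n 1)) / M\<rfloor>) * d x z)))"
proof -
  interpret Metric_space X d by fact
  let ?k = "first_contraction lam"
  have T: "T \<in> X \<rightarrow> X"
    and lam: "\<forall>k\<ge>1. 0 < lam k \<and> lam k \<le> 1"
    and event: "\<forall>k\<ge>1. \<forall>x\<in>X. \<forall>y\<in>X. d ((T ^^ n k) x) ((T ^^ n k) y) \<le> cum_factor lam k * d x y"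
    using assms(4) by (auto simp: vlc_with_def nonexpansive_map_def)
  have k: "1 \<le> ?k \<and> cum_factor lam ?k < 1"
    unfolding first_contraction_def by (rule LeastI_ex) (use assms(5) in blast)
  have con: "d ((T ^^ n ?k) x) ((T ^^ n ?k) y) \<le> cum_factor lam ?k * d x y"
    if "x \<in> X" "y \<in> X" for x y
    using event k that by blast
  note fixpoint = contractive_iterate_fixpoint
    [where N = "n ?k", OF assms(2,3) T conjunct2[OF k] con]
  have fixed: "T z = z" if "z \<in> X" "(T ^^ n ?k) z = z" for z
    using fixpoint(2) that by blast
  have gaps: "real (n (Suc k)) - real (n k) \<le> M"
    if "(SUP k\<in>{1..}. ereal (real (n (Suc k)) - real (n k))) \<le> ereal M" "1 \<le> k" for M :: real and k
    using that by (auto simp: SUP_le_iff)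
  show ?thesis
  proof (intro conjI ballI allI impI fixpoint(1)
      cum_factor_tendsto_0_iff_lim[OF lam] cum_factor_tendsto_0_iff_suminf_ln[OF lam])
    fix z
    assume "z \<in> X" "(T ^^ n ?k) z = z"
    then show "T z = z"
      by (rule fixed)
  next
    fix z x k
    assume "z \<in> X" "(T ^^ n ?k) z = z" "x \<in> X" "1 \<le> (k::nat)"
    then show "d ((T ^^ n k) x) z \<le> cum_factor lam k * d x z"
      using vlc_dist_fixpoint_le[OF assms(4) fixed] by blast
  next
    fix z x
    assume "z \<in> X" "(T ^^ n ?k) z = z" "x \<in> X" "cum_factor lam \<longlonglongrightarrow> 0"
    then show "limitin mtopology (\<lambda>m. (T ^^ m) x) z sequentially"
      using vlc_orbit_tendsto[OF assms(4) fixed] by blast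
  next
    fix z x m and M :: real
    assume "z \<in> X" "(T ^^ n ?k) z = z" "x \<in> X" "n 1 \<le> m"
      and "(SUP k\<in>{1..}. ereal (real (n (Suc k)) - real (n k))) \<le> ereal M"
    then show "d ((T ^^ m) x) z \<le> cum_factor lam (1 + nat \<lfloor>(real m - real (n 1)) / M\<rfloor>) * d x z"
      by (intro vlc_rate_of_bounded_gaps[OF assms(4) fixed] gaps)
  qed
qed

end
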